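(* Let $R$ be a discrete commutative ring and let $A$ be a (discrete) commutative $R$-algebra which is complete with respect to the $I$-adic topology induced by some ideal $I\subset A$. Let $A_*\in \mathrm{CAlg}(\widehat{\mathrm{Fil}}_R)$ be a discrete complete filtered algebra with underlying object $A$. Suppose there is an inclusion $$A_1\longrightarrow I$$ of $A$-modules inducing an equivalence $$\mathrm{gr}(A_* )\simeq \mathrm{gr}(F_I^*(A))$$ of graded objects, where $I/I^2$ is of pure weight $1$. Then $A_*=F_I^*(A)$; that is, the filtration in question is the $I$-adic filtration.
   Context: $\mathrm{Mod}_R$ is the $\infty$-category of $R$-module spectra and $\mathrm{Fil}_R=\mathrm{Fun}(\mathbb{Z}^{\mathrm{op}},\mathrm{Mod}_R)$ is the $\infty$-category of filtered $R$-modules $\cdots\to M_{n+1}\to M_n\to M_{n-1}\to\cdots$, symmetric monoidal under Day convolution. The underlying object of $M$ is $\mathrm{Und}(M)=\mathrm{colim}_{n\to-\infty}M_n$, and the associated graded is $\mathrm{gr}(M)=\bigoplus_n \mathrm{cofib}(M_{n+1}\to M_n)$, with the $n$-th summand in weight $n$. $M$ is complete if $\lim_{n\to\infty}M_n\simeq 0$; $\widehat{\mathrm{Fil}}_R\subset \mathrm{Fil}_R$ is the full subcategory of complete objects, with the completed tensor product, and $\mathrm{CAlg}(\widehat{\mathrm{Fil}}_R)$ is its category of commutative algebra objects (complete, multiplicative filtrations). A filtered module is discrete if every $M_n$ is concentrated in homotopical degree $0$. $A_1$ denotes the term of $A_*$ in filtering degree $1$. For an ideal $I\subset A$, the $I$-adic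 filtration $F_I^*(A)$ is given by $F_I^n(A)=A$ for $n\le 0$ and $F_I^n(A)=I^n$ for $n\ge 1$. *)

theory Defs
  imports "HOL-Algebra.Module" "HOL-Algebra.QuotRing" "HOL-Algebra.Ideal_Product"
begin

definition mod_hom ::
  "('r, 'k) ring_scheme \<Rightarrow> ('r, 'a, 'b) module_scheme \<Rightarrow> ('r, 'c, 'd) module_scheme \<Rightarrow> ('a \<Rightarrow> 'c) set"
  where "mod_hom R M N =
    {h \<in> carrier M \<rightarrow> carrier N.
       (\<forall>x\<in>carrier M. \<forall>y\<in>carrier M. h (x \<oplus>\<^bsub>M\<^esub> y) = h x \<oplus>\<^bsub>N\<^esub> h y) \<and>
       (\<forall>r\<in>carrier R. \<forall>x\<in>carrier M. h (r \<odot>\<^bsub>M\<^esub> x) = r \<odot>\<^bsub>N\<^esub> h x)}"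

definition mod_iso ::
  "('r, 'k) ring_scheme \<Rightarrow> ('r, 'a, 'b) module_scheme \<Rightarrow> ('r, 'c, 'd) module_scheme \<Rightarrow> ('a \<Rightarrow> 'c) set"
  where "mod_iso R M N = {h \<in> mod_hom R M N. bij_betw h (carrier M) (carrier N)}"

text \<open>
  Discrete filtered algebras.  A discrete object of \<open>CAlg(Fil_R)\<close> is a lax symmetric monoidal
  functor from \<open>(\<int>\<^sup>o\<^sup>p, +)\<close> to ordinary \<open>R\<close>-modules: the terms are discrete, so the
  coherence data of an \<open>E\<^sub>\<infinity>\<close>-structure reduce to pairings between the terms
  satisfying strict identities.  Since maps out of a completed tensor product into a complete object
  are the same as maps out of the Day convolution product, an object of \<open>CAlg\<close> of the complete
  filtered modules is such an algebra whose filtration is complete.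

  The transition maps \<open>ftrans F n : F\<^sub>n\<^sub>+\<^sub>1 \<rightarrow> F\<^sub>n\<close> are \<^emph>\<open>not\<close> assumed injective.
  The ring multiplication and unit fields of the module records \<open>fobj F n\<close> play no role.
\<close>

record ('r, 'm) filt_alg =
  fobj :: "int \<Rightarrow> ('r, 'm) module"
  ftrans :: "int \<Rightarrow> 'm \<Rightarrow> 'm"
  fmult :: "int \<Rightarrow> int \<Rightarrow> 'm \<Rightarrow> 'm \<Rightarrow> 'm"
  fone :: 'm

abbreviation fcarrier :: "('r, 'm) filt_alg \<Rightarrow> int \<Rightarrow> 'm set"
  where "fcarrier F n \<equiv> carrier (fobj F n)"

locale discrete_filtered_algebra =
  fixes R :: "('r, 'k) ring_scheme" and F :: "('r, 'm) filt_alg"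
  assumes obj_module: "\<And>n. module R (fobj F n)"
    and trans_hom: "\<And>n. ftrans F n \<in> mod_hom R (fobj F (n + 1)) (fobj F n)"
    and mult_hom: "\<And>m n x. x \<in> fcarrier F m \<Longrightarrow>
          fmult F m n x \<in> mod_hom R (fobj F n) (fobj F (m + n))"
    and mult_comm: "\<And>m n x y. \<lbrakk>x \<in> fcarrier F m; y \<in> fcarrier F n\<rbrakk> \<Longrightarrow>
          fmult F m n x y = fmult F n m y x"
    and mult_assoc: "\<And>l m n x y z. \<lbrakk>x \<in> fcarrier F l; y \<in> fcarrier F m; z \<in> fcarrier F n\<rbrakk> \<Longrightarrow>
          fmult F (l + m) n (fmult F l m x y) z = fmult F l (m + n) x (fmult F m n y z)"
    and mult_trans: "\<And>m n x y. \<lbrakk>x \<in> fcarrier F (m + 1); y \<in> fcarrier F n\<rbrakk> \<Longrightarrow>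
          fmult F m n (ftrans F m x) y = ftrans F (m + n) (fmult F (m + 1) n x y)"
    and one_closed: "fone F \<in> fcarrier F 0"
    and one_mult: "\<And>n x. x \<in> fcarrier F n \<Longrightarrow> fmult F 0 n (fone F) x = x"

text \<open>
  The limit of the tower in the derived category is the fibre of the map
  \<open>(x\<^sub>n) \<mapsto> (x\<^sub>n - ftrans (x\<^sub>n\<^sub>+\<^sub>1))\<close> on the product of all terms, so it vanishes
  iff this map is bijective (i.e. both \<open>lim\<close> and \<open>lim\<^sup>1\<close> vanish).
\<close>

definition complete_filtration :: "('r, 'm) filt_alg \<Rightarrow> bool"
  where "complete_filtration F \<longleftrightarrow>
    bij_betw (\<lambda>x n. x n \<ominus>\<^bsub>fobj F n\<^esub> ftrans F n (x (n + 1)))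
      (Pi UNIV (fcarrier F)) (Pi UNIV (fcarrier F))"

text \<open>\<open>fdown F k n\<close> is the composite transition map \<open>F\<^sub>n \<rightarrow> F\<^sub>n\<^sub>-\<^sub>k\<close>.\<close>

primrec fdown :: "('r, 'm) filt_alg \<Rightarrow> nat \<Rightarrow> int \<Rightarrow> 'm \<Rightarrow> 'm"
  where
    "fdown F 0 n x = x"
  | "fdown F (Suc k) n x = ftrans F (n - int k - 1) (fdown F k n x)"

text \<open>
  \<open>A\<close> is the underlying algebra \<open>colim\<^sub>n\<^sub>\<rightarrow>\<^sub>-\<^sub>\<infinity> F\<^sub>n\<close>: a
  multiplicative cocone \<open>u\<close> for which the induced map from the filtered colimit is bijective.
  The colimit is the disjoint union of the terms modulo having a common image in some term.
\<close>

locale underlying_algebra =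
  fixes R :: "('r, 'k) ring_scheme" and F :: "('r, 'm) filt_alg"
    and A :: "('r, 'a) module" and u :: "int \<Rightarrow> 'm \<Rightarrow> 'a"
  assumes cocone_hom: "\<And>n. u n \<in> mod_hom R (fobj F n) A"
    and cocone_trans: "\<And>n x. x \<in> fcarrier F (n + 1) \<Longrightarrow> u n (ftrans F n x) = u (n + 1) x"
    and cocone_mult: "\<And>m n x y. \<lbrakk>x \<in> fcarrier F m; y \<in> fcarrier F n\<rbrakk> \<Longrightarrow>
          u (m + n) (fmult F m n x y) = u m x \<otimes>\<^bsub>A\<^esub> u n y"
    and cocone_one: "u 0 (fone F) = \<one>\<^bsub>A\<^esub>"
    and colim_inj: "\<And>m n x y. \<lbrakk>x \<in> fcarrier F m; y \<in> fcarrier F n; u m x = u n y\<rbrakk> \<Longrightarrow>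
          \<exists>j k. m - int j = n - int k \<and> fdown F j m x = fdown F k n y"
    and colim_surj: "\<And>a. a \<in> carrier A \<Longrightarrow> \<exists>n. \<exists>x\<in>fcarrier F n. u n x = a"

primrec ideal_pow :: "('a, 'b) ring_scheme \<Rightarrow> 'a set \<Rightarrow> nat \<Rightarrow> 'a set"
  where
    "ideal_pow A I 0 = carrier A"
  | "ideal_pow A I (Suc n) = ideal_prod A (ideal_pow A I n) I"

text \<open>
  Completeness in the \<open>I\<close>-adic topology (separatedness included): \<open>A \<rightarrow> lim A/I\<^sup>n\<close> is
  bijective.  A coset of \<open>I\<^sup>n\<^sup>+\<^sup>1\<close> maps to the unique coset of \<open>I\<^sup>n\<close> containing it.
\<close>

definition adically_complete :: "('a, 'b) ring_scheme \<Rightarrow> 'a set \<Rightarrow> bool"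
  where "adically_complete A I \<longleftrightarrow>
    bij_betw (\<lambda>a n. ideal_pow A I n +>\<^bsub>A\<^esub> a) (carrier A)
      {s. (\<forall>n. s n \<in> carrier (A Quot (ideal_pow A I n))) \<and> (\<forall>n. s (Suc n) \<subseteq> s n)}"

definition adic_filtration :: "('r, 'a) module \<Rightarrow> 'a set \<Rightarrow> ('r, 'a) filt_alg"
  where "adic_filtration A I =
    \<lparr> fobj = (\<lambda>n. A\<lparr>carrier := (if n \<le> 0 then carrier A else ideal_pow A I (nat n))\<rparr>),
      ftrans = (\<lambda>n x. x),
      fmult = (\<lambda>m n x y. x \<otimes>\<^bsub>A\<^esub> y),
      fone = \<one>\<^bsub>A\<^esub> \<rparr>"

text \<open>
  The weight \<open>n\<close> part of the associated graded is the cofibre of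
  \<open>F\<^sub>n\<^sub>+\<^sub>1 \<rightarrow> F\<^sub>n\<close>.  Its homotopy modules are the cokernel (degree 0) and the
  kernel (degree 1) of the transition map, all others being zero.
\<close>

definition fimage :: "('r, 'm) filt_alg \<Rightarrow> int \<Rightarrow> 'm set"
  where "fimage F n = ftrans F n ` fcarrier F (n + 1)"

definition gr_pi0 :: "('r, 'm) filt_alg \<Rightarrow> int \<Rightarrow> ('r, 'm set) module"
  where "gr_pi0 F n =
    \<lparr> carrier = a_rcosets\<^bsub>fobj F n\<^esub> (fimage F n),
      mult = undefined, one = undefined,
      zero = fimage F n,
      add = set_add (fobj F n),
      smult = (\<lambda>r C. (\<Union>x\<in>C. fimage F n +>\<^bsub>fobj F n\<^esub> (r \<odot>\<^bsub>fobj F n\<^esub> x))) \<rparr>"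

definition gr_pi1 :: "('r, 'm) filt_alg \<Rightarrow> int \<Rightarrow> ('r, 'm) module"
  where "gr_pi1 F n =
    (fobj F (n + 1))\<lparr>carrier := a_kernel (fobj F (n + 1)) (fobj F n) (ftrans F n)\<rparr>"

text \<open>
  An equivalence \<open>gr F \<simeq> gr G\<close> of graded objects of the derived category, in the case that
  the transition maps of \<open>G\<close> are injective (as for an adic filtration).  Then \<open>gr G\<close> is
  discrete while \<open>gr F\<close> is connective, so a map \<open>gr F \<rightarrow> gr G\<close> is the same as a family
  of module maps \<open>\<phi> n\<close> on \<open>\<pi>\<^sub>0\<close>, and it is an equivalence iff it is an isomorphism
  on \<open>\<pi>\<^sub>0\<close> and on \<open>\<pi>\<^sub>1\<close>, i.e. iff moreover \<open>\<pi>\<^sub>1\<close> of \<open>gr F\<close> vanishes.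
\<close>

definition gr_equivalence ::
  "('r, 'k) ring_scheme \<Rightarrow> ('r, 'm) filt_alg \<Rightarrow> ('r, 'a) filt_alg \<Rightarrow> (int \<Rightarrow> 'm set \<Rightarrow> 'a set) \<Rightarrow> bool"
  where "gr_equivalence R F G \<phi> \<longleftrightarrow>
    (\<forall>n. \<phi> n \<in> mod_iso R (gr_pi0 F n) (gr_pi0 G n) \<and>
         mod_iso R (gr_pi1 F n) (gr_pi1 G n) \<noteq> {})"

text \<open>
  \<open>\<phi>\<close> is induced by \<open>f\<close>: it sends the class of \<open>x \<in> F\<^sub>n\<close> to the class of
  \<open>f n x\<close> whenever the latter class makes sense, i.e. whenever \<open>f n x\<close> lies in \<open>G\<^sub>n\<close>.
  The maps \<open>f n\<close> are not required to send all of \<open>F\<^sub>n\<close> to \<open>G\<^sub>n\<close>.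
\<close>

definition induced_on_gr ::
  "('r, 'm) filt_alg \<Rightarrow> ('r, 'a) filt_alg \<Rightarrow> (int \<Rightarrow> 'm \<Rightarrow> 'a) \<Rightarrow> (int \<Rightarrow> 'm set \<Rightarrow> 'a set) \<Rightarrow> bool"
  where "induced_on_gr F G f \<phi> \<longleftrightarrow>
    (\<forall>n. \<forall>x\<in>fcarrier F n. f n x \<in> fcarrier G n \<longrightarrow>
       \<phi> n (fimage F n +>\<^bsub>fobj F n\<^esub> x) = fimage G n +>\<^bsub>fobj G n\<^esub> f n x)"

definition filtered_algebra_iso ::
  "('r, 'k) ring_scheme \<Rightarrow> ('r, 'm) filt_alg \<Rightarrow> ('r, 'a) filt_alg \<Rightarrow> (int \<Rightarrow> 'm \<Rightarrow> 'a) \<Rightarrow> bool"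
  where "filtered_algebra_iso R F G f \<longleftrightarrow>
    (\<forall>n. f n \<in> mod_iso R (fobj F n) (fobj G n)) \<and>
    (\<forall>n. \<forall>x\<in>fcarrier F (n + 1). f n (ftrans F n x) = ftrans G n (f (n + 1) x)) \<and>
    (\<forall>m n. \<forall>x\<in>fcarrier F m. \<forall>y\<in>fcarrier F n.
       f (m + n) (fmult F m n x y) = fmult G m n (f m x) (f n y)) \<and>
    f 0 (fone F) = fone G"

end

theory Submission
  imports Defs
begin

text \<open>
  Since the transition maps of \<open>F\<close> have no kernel, \<open>u\<close> identifies \<open>F\<close> with a decreasing
  filtration \<open>J\<close> of \<open>A\<close>.  The graded equivalence induced by \<open>u\<close> shows that an element of
  \<open>J\<^sub>n\<close> which lies in \<open>I\<^sup>n\<close> belongs to \<open>J\<^sub>n\<^sub>+\<^sub>1\<close> iff it belongs to \<open>I\<^sup>n\<^sup>+\<^sup>1\<close>.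
  In negative weights this gives \<open>J\<^sub>n = J\<^sub>n\<^sub>+\<^sub>1\<close>, hence \<open>J\<^sub>0 = A\<close> by exhaustion;
  from there induction on \<open>n\<close> yields \<open>J\<^sub>n = I\<^sup>n\<close>.
\<close>

section \<open>Additive maps and cosets of additive subgroups\<close>

lemma abelian_group_hom_of_mod_hom:
  assumes "module R M" and "module R N" and "h \<in> mod_hom R M N"
  shows "abelian_group_hom M N h"
proof -
  interpret M: module R M by fact
  interpret N: module R N by fact
  have "h \<in> hom (add_monoid M) (add_monoid N)"
    using assms(3) by (simp add: mod_hom_def hom_def)
  then have "group_hom (add_monoid M) (add_monoid N) h"
    by (intro group_hom.intro group_hom_axioms.intro M.a_group N.a_group)
  then show ?thesis
    by (intro abelian_group_homI M.abelian_group_axioms N.abelian_group_axioms)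
qed

text \<open>Translates membership into triviality of a coset, which is the form in which \<phi>
  carries information.\<close>

lemma a_r_coset_eq_subgroup_iff:
  assumes "abelian_group M" and "additive_subgroup H M" and "x \<in> carrier M"
  shows "H +>\<^bsub>M\<^esub> x = H \<longleftrightarrow> x \<in> H"
proof -
  interpret abelian_group M by fact
  interpret additive_subgroup H M by fact
  show ?thesis
    using a_coset_join1[OF _ assms(3) a_subgroup] a_coset_join2[OF assms(3) a_subgroup]
    by blast
qed

section \<open>Powers of an ideal and the terms of the adic filtration\<close>

lemma ideal_ideal_pow:
  assumes "ring A" and "ideal I A"
  shows "ideal (ideal_pow A I n) A"
proof (induction n)
  case 0
  show ?case using ring.oneideal[OF assms(1)] by simp
next
  case (Suc n)
  then show ?case using ring.ideal_prod_is_ideal[OF assms(1) Suc assms(2)] by simp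
qed

lemma ideal_pow_Suc_subset:
  assumes "ring A" and "ideal I A"
  shows "ideal_pow A I (Suc n) \<subseteq> ideal_pow A I n"
  using ring.ideal_prod_inter[OF assms(1) ideal_ideal_pow[OF assms] assms(2)] by simp

text \<open>Since \<open>nat\<close> sends negative weights to 0 and the zeroth power is all of
  \<open>A\<close>, one formula covers both cases of the adic filtration.\<close>

lemma fcarrier_adic_filtration:
  "fcarrier (adic_filtration A I) n = ideal_pow A I (nat n)"
  by (simp add: adic_filtration_def)

lemma fimage_adic_filtration:
  "fimage (adic_filtration A I) n = ideal_pow A I (nat (n + 1))"
  by (simp add: adic_filtration_def fimage_def)

text \<open>Cosets are formed with the addition alone, which shrinking the carrier leaves
  unchanged.\<close>

lemma a_r_coset_adic_filtration:
  "H +>\<^bsub>fobj (adic_filtration A I) n\<^esub> x = H +>\<^bsub>A\<^esub> x"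
  by (simp add: adic_filtration_def a_r_coset_def r_coset_def)

lemma ideal_pow_nat_antimono:
  assumes "ring A" and "ideal I A"
  shows "ideal_pow A I (nat (n + 1)) \<subseteq> ideal_pow A I (nat n)"
  using ideal_pow_Suc_subset[OF assms, of "nat n"]
  by (cases "n \<ge> 0") (simp_all add: nat_add_distrib)

section \<open>Transition maps and the cocone to the underlying algebra\<close>

context discrete_filtered_algebra
begin

lemma trans_closed: "x \<in> fcarrier F (n + 1) \<Longrightarrow> ftrans F n x \<in> fcarrier F n"
  using trans_hom[of n] by (auto simp: mod_hom_def)

lemma abelian_group_hom_trans: "abelian_group_hom (fobj F (n + 1)) (fobj F n) (ftrans F n)"
  by (rule abelian_group_hom_of_mod_hom[OF obj_module obj_module trans_hom])

lemma additive_subgroup_fimage: "additive_subgroup (fimage F n) (fobj F n)"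
proof -
  interpret h: abelian_group_hom "fobj F (n + 1)" "fobj F n" "ftrans F n"
    by (rule abelian_group_hom_trans)
  show ?thesis
    using group_hom.img_is_subgroup[OF h.a_group_hom]
    by (simp add: additive_subgroup_def fimage_def)
qed

lemma inj_on_trans:
  assumes "a_kernel (fobj F (n + 1)) (fobj F n) (ftrans F n) = {\<zero>\<^bsub>fobj F (n + 1)\<^esub>}"
  shows "inj_on (ftrans F n) (fcarrier F (n + 1))"
proof -
  interpret h: abelian_group_hom "fobj F (n + 1)" "fobj F n" "ftrans F n"
    by (rule abelian_group_hom_trans)
  show ?thesis
    using group_hom.inj_iff_trivial_ker[OF h.a_group_hom] assms
    by (simp add: a_kernel_def)
qed

lemma fdown_closed: "x \<in> fcarrier F n \<Longrightarrow> fdown F k n x \<in> fcarrier F (n - int k)"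
proof (induction k)
  case (Suc k)
  then show ?case
    using trans_closed[of "fdown F k n x" "n - int k - 1"] by (simp add: algebra_simps)
qed simp

lemma inj_on_fdown:
  assumes "\<And>n. inj_on (ftrans F n) (fcarrier F (n + 1))"
  shows "inj_on (fdown F k n) (fcarrier F n)"
proof (induction k)
  case (Suc k)
  have "fdown F k n x \<in> fcarrier F (n - int k - 1 + 1)" if "x \<in> fcarrier F n" for x
    using fdown_closed[OF that, of k] by simp
  with Suc show ?case
    using assms[of "n - int k - 1"] by (simp add: inj_on_def)
qed simp

text \<open>Elements identified in the colimit already agree after finitely many transition maps,
  and these are injective.\<close>

lemma inj_on_cocone:
  assumes "underlying_algebra R F A u"
    and "\<And>n. inj_on (ftrans F n) (fcarrier F (n + 1))"
  shows "inj_on (u n) (fcarrier F n)"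
proof (rule inj_onI)
  fix x y assume xy: "x \<in> fcarrier F n" "y \<in> fcarrier F n" "u n x = u n y"
  obtain j k where jk: "n - int j = n - int k" "fdown F j n x = fdown F k n y"
    using underlying_algebra.colim_inj[OF assms(1) xy] by blast
  \<comment> \<open>Both elements start in weight \<open>n\<close> and end in the same weight, so
    \<open>j = k\<close> and a single composite is involved.\<close>
  then show "x = y"
    using inj_on_fdown[OF assms(2), of k n] xy by (auto dest: inj_onD)
qed

lemma cocone_fdown:
  assumes "underlying_algebra R F A u" and "x \<in> fcarrier F n"
  shows "u (n - int k) (fdown F k n x) = u n x"
proof (induction k)
  case (Suc k)
  then show ?case
    using underlying_algebra.cocone_trans[OF assms(1), of "fdown F k n x" "n - int k - 1"]
      fdown_closed[OF assms(2), of k]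
    by (simp add: algebra_simps)
qed simp

text \<open>Inside \<open>A\<close> the image of a transition map becomes the next term of the
  filtration, so statements about \<open>fimage\<close> turn into statements comparing consecutive
  terms.\<close>

lemma cocone_image_fimage:
  assumes "underlying_algebra R F A u"
  shows "u n ` fimage F n = u (n + 1) ` fcarrier F (n + 1)"
  unfolding fimage_def image_image
  using underlying_algebra.cocone_trans[OF assms] by (intro image_cong) simp_all

lemma cocone_image_nonpos_eq:
  assumes "underlying_algebra R F A u"
    and surj: "\<And>n. n < 0 \<Longrightarrow> fimage F n = fcarrier F n" and "n \<le> 0"
  shows "u n ` fcarrier F n = carrier A"
proof -
  have nonpos: "u m ` fcarrier F m = u 0 ` fcarrier F 0" if "m \<le> 0" for m
    using that
  proof (induction m rule: int_le_induct)
    case (step i)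
    then show ?case
      using cocone_image_fimage[OF assms(1), of "i - 1"] surj[of "i - 1"] by simp
  qed simp
  have "a \<in> u 0 ` fcarrier F 0" if a: "a \<in> carrier A" for a
  proof -
    obtain m x where mx: "x \<in> fcarrier F m" "u m x = a"
      using underlying_algebra.colim_surj[OF assms(1) a] by blast
    \<comment> \<open>Descending \<open>nat m\<close> steps brings a positive weight to 0 and leaves
      any other weight fixed, so the weight reached is at most 0.\<close>
    let ?k = "nat m"
    have "a \<in> u (m - int ?k) ` fcarrier F (m - int ?k)"
      using cocone_fdown[OF assms(1) mx(1), of ?k] fdown_closed[OF mx(1), of ?k] mx(2)
      by (intro image_eqI[where x = "fdown F ?k m x"]) simp_all
    then show ?thesis
      using nonpos[of "m - int ?k"] by simp
  qed
  moreover have "u 0 ` fcarrier F 0 \<subseteq> carrier A"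
    using underlying_algebra.cocone_hom[OF assms(1), of 0] by (auto simp: mod_hom_def)
  ultimately show ?thesis using nonpos[OF assms(3)] by blast
qed

section \<open>Consequences of the graded equivalence\<close>

text \<open>The transition maps of the adic filtration are inclusions, so its graded pieces have
  trivial \<open>gr_pi1\<close>; the equivalence transfers this to the kernels in
  \<open>F\<close>.\<close>

lemma inj_on_trans_of_gr_equivalence_adic:
  assumes "ring A" and "ideal I A" and "gr_equivalence R F (adic_filtration A I) \<phi>"
  shows "inj_on (ftrans F n) (fcarrier F (n + 1))"
proof -
  let ?G = "adic_filtration A I"
  interpret h: abelian_group_hom "fobj F (n + 1)" "fobj F n" "ftrans F n"
    by (rule abelian_group_hom_trans)
  interpret J: ideal "ideal_pow A I (nat (n + 1))" A
    by (rule ideal_ideal_pow[OF assms(1,2)])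
  let ?K = "a_kernel (fobj F (n + 1)) (fobj F n) (ftrans F n)"
  obtain g where g: "g \<in> mod_iso R (gr_pi1 F n) (gr_pi1 ?G n)"
    using assms(3) by (auto simp: gr_equivalence_def)
  have "carrier (gr_pi1 ?G n) = {\<zero>\<^bsub>A\<^esub>}"
    using J.zero_closed
    by (auto simp: gr_pi1_def a_kernel_def kernel_def adic_filtration_def)
  then have bij: "bij_betw g ?K {\<zero>\<^bsub>A\<^esub>}"
    using g by (simp add: mod_iso_def gr_pi1_def)
  have zero: "\<zero>\<^bsub>fobj F (n + 1)\<^esub> \<in> ?K"
    by (rule additive_subgroup.zero_closed[OF h.additive_subgroup_a_kernel])
  \<comment> \<open>A set in bijection with a one-point set has one element, and the kernel contains
    zero.\<close>
  have "?K \<subseteq> {\<zero>\<^bsub>fobj F (n + 1)\<^esub>}"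
  proof
    fix x assume x: "x \<in> ?K"
    have "g x = g \<zero>\<^bsub>fobj F (n + 1)\<^esub>"
      using bij_betwE[OF bij] x zero by simp
    then have "x = \<zero>\<^bsub>fobj F (n + 1)\<^esub>"
      by (rule inj_onD[OF bij_betw_imp_inj_on[OF bij] _ x zero])
    then show "x \<in> {\<zero>\<^bsub>fobj F (n + 1)\<^esub>}" by simp
  qed
  with zero have "?K = {\<zero>\<^bsub>fobj F (n + 1)\<^esub>}" by blast
  then show ?thesis
    by (rule inj_on_trans)
qed

text \<open>Both sides say that a class in weight \<open>n\<close> is zero, and
  \<open>\<phi> n\<close> matches these classes injectively. The assumption that
  \<open>u n x\<close> lies in the adic term is what lets \<open>induced_on_gr\<close> compute the
  image of the class of \<open>x\<close>.\<close>

lemma mem_fimage_iff_of_gr_equivalence_adic: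
  assumes "algebra R A" and "ideal I A" and "underlying_algebra R F A u"
    and "gr_equivalence R F (adic_filtration A I) \<phi>"
    and "induced_on_gr F (adic_filtration A I) u \<phi>"
    and x: "x \<in> fcarrier F n" "u n x \<in> ideal_pow A I (nat n)"
  shows "x \<in> fimage F n \<longleftrightarrow> u n x \<in> ideal_pow A I (nat (n + 1))"
proof -
  let ?G = "adic_filtration A I" and ?M = "fobj F n"
  interpret A: algebra R A by fact
  interpret M: module R ?M by (rule obj_module)
  interpret h: abelian_group_hom ?M A "u n"
    by (rule abelian_group_hom_of_mod_hom[OF obj_module A.module_axioms
          underlying_algebra.cocone_hom[OF assms(3)]])
  interpret J: ideal "ideal_pow A I (nat n)" A
    by (rule ideal_ideal_pow[OF A.ring_axioms assms(2)])
  interpret J': ideal "ideal_pow A I (nat (n + 1))" A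
    by (rule ideal_ideal_pow[OF A.ring_axioms assms(2)])
  have \<phi>: "\<phi> n (fimage F n +>\<^bsub>?M\<^esub> y) = ideal_pow A I (nat (n + 1)) +>\<^bsub>A\<^esub> u n y"
    if "y \<in> fcarrier F n" "u n y \<in> ideal_pow A I (nat n)" for y
    using assms(5) that
    by (auto simp: induced_on_gr_def fcarrier_adic_filtration fimage_adic_filtration
        a_r_coset_adic_filtration)
  have F_iff: "fimage F n +>\<^bsub>?M\<^esub> y = fimage F n \<longleftrightarrow> y \<in> fimage F n"
    if "y \<in> fcarrier F n" for y
    by (rule a_r_coset_eq_subgroup_iff[OF M.abelian_group_axioms additive_subgroup_fimage that])
  have A_iff: "ideal_pow A I (nat (n + 1)) +>\<^bsub>A\<^esub> a = ideal_pow A I (nat (n + 1)) \<longleftrightarrow>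
      a \<in> ideal_pow A I (nat (n + 1))" if "a \<in> carrier A" for a
    by (rule a_r_coset_eq_subgroup_iff[OF A.abelian_group_axioms J'.additive_subgroup_axioms that])
  have zero: "fimage F n +>\<^bsub>?M\<^esub> \<zero>\<^bsub>?M\<^esub> = fimage F n"
    using F_iff additive_subgroup.zero_closed[OF additive_subgroup_fimage] by simp
  \<comment> \<open>Zero always maps into the adic term, so inducedness applied to it shows that the
    zero class goes to the zero class.\<close>
  have \<phi>0: "\<phi> n (fimage F n) = ideal_pow A I (nat (n + 1))"
    using \<phi>[of "\<zero>\<^bsub>?M\<^esub>"] A_iff[of "\<zero>\<^bsub>A\<^esub>"] by (simp add: zero)
  have coset: "fimage F n +>\<^bsub>?M\<^esub> y \<in> carrier (gr_pi0 F n)" if "y \<in> fcarrier F n" for y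
    using that by (auto simp: gr_pi0_def A_RCOSETS_def RCOSETS_def a_r_coset_def)
  have "inj_on (\<phi> n) (carrier (gr_pi0 F n))"
    using assms(4) by (auto simp: gr_equivalence_def mod_iso_def bij_betw_def)
  then have "\<phi> n (fimage F n +>\<^bsub>?M\<^esub> x) = \<phi> n (fimage F n) \<longleftrightarrow>
      fimage F n +>\<^bsub>?M\<^esub> x = fimage F n"
    using coset[OF x(1)] coset[of "\<zero>\<^bsub>?M\<^esub>"] zero by (auto simp: inj_on_eq_iff)
  then show ?thesis
    using F_iff[OF x(1)] \<phi>[OF x] \<phi>0 A_iff[of "u n x"] x(1) by simp
qed

lemma cocone_image_eq_ideal_pow:
  assumes "algebra R A" and "ideal I A" and "underlying_algebra R F A u"
    and "gr_equivalence R F (adic_filtration A I) \<phi>"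
    and "induced_on_gr F (adic_filtration A I) u \<phi>"
  shows "u n ` fcarrier F n = ideal_pow A I (nat n)"
proof -
  interpret A: algebra R A by fact
  note mem_iff = mem_fimage_iff_of_gr_equivalence_adic[OF assms]
  have u_closed: "u n x \<in> carrier A" if "x \<in> fcarrier F n" for n x
    using underlying_algebra.cocone_hom[OF assms(3), of n] that by (auto simp: mod_hom_def)
  have fimage_sub: "fimage F n \<subseteq> fcarrier F n" for n
    using trans_closed by (auto simp: fimage_def)
  \<comment> \<open>For negative \<open>n\<close>, up to and including -1, both \<open>nat n\<close>
    and \<open>nat (n + 1)\<close> are 0, so both adic conditions in \<open>mem_iff\<close> hold for
    every element.\<close>
  have surj: "fimage F n = fcarrier F n" if "n < 0" for n
    using mem_iff[of _ n] u_closed fimage_sub[of n] that by auto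
  show ?thesis
  proof (cases "n \<ge> 0")
    case True
    then show ?thesis
    proof (induction n rule: int_ge_induct)
      case base
      show ?case using cocone_image_nonpos_eq[OF assms(3) surj, of 0] by simp
    next
      case (step n)
      \<comment> \<open>By the induction hypothesis \<open>u n\<close> sends the whole term into the
        adic term, so \<open>mem_iff\<close> applies to all of its elements.\<close>
      have "fimage F n = {x \<in> fcarrier F n. u n x \<in> ideal_pow A I (nat (n + 1))}"
        using mem_iff[of _ n] step.IH fimage_sub[of n] by auto
      then have "u n ` fimage F n = u n ` fcarrier F n \<inter> ideal_pow A I (nat (n + 1))"
        by auto
      \<comment> \<open>Here the induction hypothesis is used as an equality: the image contains the
        \<open>n\<close>-th power, hence the next one.\<close>
      also have "\<dots> = ideal_pow A I (nat (n + 1))"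
        using ideal_pow_nat_antimono[OF A.ring_axioms assms(2), of n] step.IH by auto
      finally show ?case
        using cocone_image_fimage[OF assms(3), of n] by simp
    qed
  next
    case False
    then show ?thesis using cocone_image_nonpos_eq[OF assms(3) surj, of n] by simp
  qed
qed

end

theorem theorem1p4:
  fixes R :: "('r, 'k) ring_scheme"
    and A :: "('r, 'a) module"
    and I :: "'a set"
    and F :: "('r, 'm) filt_alg"
    and u :: "int \<Rightarrow> 'm \<Rightarrow> 'a"
    and \<phi> :: "int \<Rightarrow> 'm set \<Rightarrow> 'a set"
  assumes "algebra R A"
    and "ideal I A"
    and "adically_complete A I"
    and "discrete_filtered_algebra R F"
    and "complete_filtration F"
    and "underlying_algebra R F A u"
    and "inj_on (u 1) (fcarrier F 1)" and "u 1 ` fcarrier F 1 \<subseteq> I"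
    and "gr_equivalence R F (adic_filtration A I) \<phi>"
    and "induced_on_gr F (adic_filtration A I) u \<phi>"
  shows "filtered_algebra_iso R F (adic_filtration A I) u"
proof -
  interpret A: algebra R A by fact
  interpret F: discrete_filtered_algebra R F by fact
  interpret u: underlying_algebra R F A u by fact
  let ?G = "adic_filtration A I"
  have "inj_on (u n) (fcarrier F n)" for n
    by (rule F.inj_on_cocone[OF assms(6)
          F.inj_on_trans_of_gr_equivalence_adic[OF A.ring_axioms assms(2,9)]])
  moreover have "u n ` fcarrier F n = fcarrier ?G n" for n
    using F.cocone_image_eq_ideal_pow[OF assms(1,2,6,9,10)]
    by (simp add: fcarrier_adic_filtration)
  ultimately have bij: "bij_betw (u n) (fcarrier F n) (fcarrier ?G n)" for n
    by (simp add: bij_betw_def)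
  then have "u n \<in> mod_iso R (fobj F n) (fobj ?G n)" for n
    using u.cocone_hom[of n] bij_betwE[OF bij, of n]
    by (auto simp: mod_iso_def mod_hom_def adic_filtration_def)
  \<comment> \<open>The adic filtration takes its product and unit from \<open>A\<close> and has
    identities as transition maps, so the cocone laws are exactly the remaining
    compatibilities.\<close>
  then show ?thesis
    using u.cocone_trans u.cocone_mult u.cocone_one
    by (simp add: filtered_algebra_iso_def adic_filtration_def)
qed

end
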